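(* Fix a state $x$. Let $\mathcal{L}$ (leader signals) and $\mathcal{A}$ (follower actions) be nonempty compact sets, and suppose that the leader utility $(\ell,a)\mapsto U_L(x,\ell,a)\in\mathbb{R}$ and the follower utility $(\ell,a)\mapsto U_F(x,\ell,a)\in\mathbb{R}$ are continuous on $\mathcal{L}\times\mathcal{A}$. Then, under optimistic tie breaking, the stage-wise game at $x$ admits a Stackelberg solution $(\ell^\star,a^\star)\in\mathcal{L}\times\mathcal{A}$.
   Context: The stage-wise game at state $x$: the leader commits to a signal $\ell\in\mathcal{L}$; the follower observes $(x,\ell)$ and chooses an action $a\in\mathcal{A}$; the payoffs are $U_L(x,\ell,a)$ for the leader and $U_F(x,\ell,a)$ for the follower. "Compact set" may be read as compact topological space, with $\mathcal{L}\times\mathcal{A}$ carrying the product topology (in the motivating application these are boxes in Euclidean space). The follower's best-response correspondence is $$\mathrm{BR}_F(x,\ell):=\arg\max_{a\in\mathcal{A}}U_F(x,\ell,a).$$ A Stackelberg solution under optimistic tie breaking (at the fixed state $x$) is a pair $(\ell^\star,a^\star)$ for which there is a function $\hat a:\mathcal{L}\to\mathcal{A}$ such that $$\hat a(\ell)\in\arg\max_{a\in\mathrm{BR}_F(x,\ell)}U_L(x,\ell,a)\quad\text{for every }\ell\in\mathcal{L},$$ $$\ell^\star\in\arg\max_{\ell\in\mathcal{L}}U_L\bigl(x,\ell,\hat a(\ell)\bigr),\qquad a^\star=\hat a(\ell^\star).$$ That is, among its best responses the follower picks one that is best for the leader, and the leader optimizes anticipating this. *)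

theory Defs
  imports Complex_Main
begin

definition argmax_set :: "('b \<Rightarrow> real) \<Rightarrow> 'b set \<Rightarrow> 'b set" where
  "argmax_set f S = {y. is_arg_max f (\<lambda>z. z \<in> S) y}"

definition best_response ::
  "'a set \<Rightarrow> ('x \<Rightarrow> 'l \<Rightarrow> 'a \<Rightarrow> real) \<Rightarrow> 'x \<Rightarrow> 'l \<Rightarrow> 'a set" where
  "best_response A U\<^sub>F x l = argmax_set (\<lambda>a. U\<^sub>F x l a) A"

text \<open>
  The follower's reply \<open>r\<close> is a total HOL function, but only its values on \<open>L\<close> matter.
\<close>

definition optimistic_stackelberg_solution ::
  "'l set \<Rightarrow> 'a set \<Rightarrow> ('x \<Rightarrow> 'l \<Rightarrow> 'a \<Rightarrow> real) \<Rightarrow> ('x \<Rightarrow> 'l \<Rightarrow> 'a \<Rightarrow> real) \<Rightarrow>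
   'x \<Rightarrow> 'l \<times> 'a \<Rightarrow> bool" where
  "optimistic_stackelberg_solution L A U\<^sub>L U\<^sub>F x = (\<lambda>(l', a').
     \<exists>r :: 'l \<Rightarrow> 'a.
       (\<forall>l\<in>L. r l \<in> argmax_set (\<lambda>a. U\<^sub>L x l a) (best_response A U\<^sub>F x l)) \<and>
       l' \<in> argmax_set (\<lambda>l. U\<^sub>L x l (r l)) L \<and>
       a' = r l')"

end

theory Submission
  imports Defs "HOL-Analysis.Elementary_Topology"
begin

text \<open>
  The graph of the best-response correspondence is relatively closed in the compact product
  \<open>L \<times> A\<close>, hence compact, so the leader's utility attains its maximum on it.
  A maximizing pair is a Stackelberg solution: at the maximizing signal the follower replies with
  the maximizing action, elsewhere with any leader-optimal best response.
\<close>

text \<open>Each inequality cuts out a relatively closed subset of \<open>S\<close>, and an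
  arbitrary intersection of such subsets is again relatively closed in \<open>S\<close>, hence
  compact. The index set is arbitrary because optimality of an action is one inequality per
  competing action.\<close>

lemma compact_Collect_ge:
  fixes f :: "'i \<Rightarrow> 'b::topological_space \<Rightarrow> real"
  assumes "compact S" and "continuous_on S g" and cont: "\<And>i. i \<in> I \<Longrightarrow> continuous_on S (f i)"
  shows "compact {s \<in> S. \<forall>i\<in>I. f i s \<le> g s}"
proof -
  \<comment> \<open>The spaces are not assumed Hausdorff, so \<open>S\<close> itself may fail to be
    closed. Relative closedness is therefore witnessed by an ambient closed set \<open>C\<close>
    with the right trace on \<open>S\<close>.\<close>
  have "\<exists>C. closed C \<and> C \<inter> S = (\<lambda>s. g s - f i s) -` {0..} \<inter> S" if "i \<in> I" for i
  proof -
    have "continuous_on S (\<lambda>s. g s - f i s)"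
      using assms that by (intro continuous_intros)
    then show ?thesis
      unfolding continuous_on_closed_invariant by simp
  qed
  then obtain C where C: "\<And>i. i \<in> I \<Longrightarrow> closed (C i)"
      "\<And>i. i \<in> I \<Longrightarrow> C i \<inter> S = (\<lambda>s. g s - f i s) -` {0..} \<inter> S"
    by metis
  have "{s \<in> S. \<forall>i\<in>I. f i s \<le> g s} = S \<inter> (\<Inter>i\<in>I. C i)"
    using C(2) by fastforce
  moreover have "closed (\<Inter>i\<in>I. C i)"
    using C(1) by blast
  ultimately show ?thesis
    using \<open>compact S\<close> by (simp add: compact_Int_closed)
qed

lemma mem_argmax_set_iff: "y \<in> argmax_set f S \<longleftrightarrow> y \<in> S \<and> (\<forall>z\<in>S. f z \<le> f y)"
  by (auto simp: argmax_set_def is_arg_max_def not_less)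

lemma argmax_set_nonempty:
  fixes f :: "'b::topological_space \<Rightarrow> real"
  assumes "compact S" "S \<noteq> {}" "continuous_on S f"
  shows "argmax_set f S \<noteq> {}"
  using continuous_attains_sup[OF assms] by (metis mem_argmax_set_iff empty_iff)

lemma compact_argmax_set:
  fixes f :: "'b::topological_space \<Rightarrow> real"
  assumes "compact S" "continuous_on S f"
  shows "compact (argmax_set f S)"
proof -
  have "argmax_set f S = {s \<in> S. \<forall>z\<in>S. f z \<le> f s}"
    by (auto simp: mem_argmax_set_iff)
  then show ?thesis
    using assms by (simp add: compact_Collect_ge)
qed

text \<open>Membership in the graph means \<open>f l b \<le> f l a\<close> for all \<open>b\<close>
  in \<open>A\<close>. For fixed \<open>b\<close> both sides are continuous in the pair
  \<open>(l, a)\<close>, so \<open>compact_Collect_ge\<close> applies on the product.\<close>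

lemma compact_argmax_graph:
  fixes f :: "'l::topological_space \<Rightarrow> 'a::topological_space \<Rightarrow> real"
  assumes "compact L" "compact A" and cont: "continuous_on (L \<times> A) (\<lambda>(l, a). f l a)"
  shows "compact (SIGMA l:L. argmax_set (f l) A)"
proof -
  have "continuous_on (L \<times> A) (\<lambda>p. f (fst p) b)" if "b \<in> A" for b
  proof -
    \<comment> \<open>Freezing the action at \<open>b\<close> is composition with
      \<open>p \<mapsto> (fst p, b)\<close>, which maps \<open>L \<times> A\<close> into
      itself.\<close>
    have "continuous_on (L \<times> A) ((\<lambda>(l, a). f l a) \<circ> (\<lambda>p. (fst p, b)))"
      by (intro continuous_on_compose continuous_intros continuous_on_subset[OF cont])
        (use that in auto)
    then show ?thesis
      by (simp add: o_def)
  qed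
  then have "compact {p \<in> L \<times> A. \<forall>b\<in>A. f (fst p) b \<le> (case p of (l, a) \<Rightarrow> f l a)}"
    using assms by (intro compact_Collect_ge compact_Times)
  moreover have "(SIGMA l:L. argmax_set (f l) A) =
      {p \<in> L \<times> A. \<forall>b\<in>A. f (fst p) b \<le> (case p of (l, a) \<Rightarrow> f l a)}"
    by (auto simp: mem_argmax_set_iff)
  ultimately show ?thesis
    by simp
qed

lemma continuous_on_section:
  assumes "continuous_on (L \<times> A) (\<lambda>(l, a). f l a)" "l \<in> L"
  shows "continuous_on A (f l)"
proof -
  have "continuous_on A ((\<lambda>(l, a). f l a) \<circ> Pair l)"
    by (intro continuous_on_compose continuous_intros continuous_on_subset[OF assms(1)])
      (use assms(2) in auto)
  then show ?thesis
    by (simp add: o_def)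
qed

theorem theorem5p1:
  fixes L :: "'l::topological_space set"
    and A :: "'a::topological_space set"
    and U\<^sub>L U\<^sub>F :: "'x \<Rightarrow> 'l \<Rightarrow> 'a \<Rightarrow> real"
    and x :: 'x
  assumes "compact L" and "L \<noteq> {}"
    and "compact A" and "A \<noteq> {}"
    and "continuous_on (L \<times> A) (\<lambda>(l, a). U\<^sub>L x l a)"
    and "continuous_on (L \<times> A) (\<lambda>(l, a). U\<^sub>F x l a)"
  shows "\<exists>(l, a) \<in> L \<times> A. optimistic_stackelberg_solution L A U\<^sub>L U\<^sub>F x (l, a)"
proof -
  define B where "B = (\<lambda>l. argmax_set (U\<^sub>F x l) A)"
  have best_response_eq: "best_response A U\<^sub>F x = B"
    unfolding B_def best_response_def by (rule ext) (rule refl)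
  define G where "G = Sigma L B"
  have B: "compact (B l)" "B l \<noteq> {}" "B l \<subseteq> A" if "l \<in> L" for l
    using continuous_on_section[OF assms(6) that] assms(3,4)
    by (auto simp: B_def compact_argmax_set argmax_set_nonempty mem_argmax_set_iff)
  have G: "G \<subseteq> L \<times> A" "G \<noteq> {}"
    using B(2,3) \<open>L \<noteq> {}\<close> unfolding G_def by (blast, metis Sigma_empty_iff equals0I)
  have "compact G"
    using compact_argmax_graph[OF assms(1,3,6)] unfolding G_def B_def .
  then obtain l' a' where p: "(l', a') \<in> G"
    and max: "\<And>l a. (l, a) \<in> G \<Longrightarrow> U\<^sub>L x l a \<le> U\<^sub>L x l' a'"
    using continuous_attains_sup[OF _ G(2) continuous_on_subset[OF assms(5) G(1)]]
    by (metis (no_types, lifting) case_prod_conv surj_pair)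
  have "argmax_set (U\<^sub>L x l) (B l) \<noteq> {}" if "l \<in> L" for l
    using B[OF that] continuous_on_section[OF assms(5) that]
    by (metis argmax_set_nonempty continuous_on_subset)
  then have "\<forall>l\<in>L. \<exists>a. a \<in> argmax_set (U\<^sub>L x l) (B l)"
    by blast
  then obtain r where r: "\<forall>l\<in>L. r l \<in> argmax_set (U\<^sub>L x l) (B l)"
    by (rule bchoice[THEN exE])
  \<comment> \<open>\<open>r l'\<close> may be a different leader-optimal reply, so the value at
    \<open>l'\<close> is overwritten to make the reply there equal to \<open>a'\<close>.\<close>
  let ?r = "r(l' := a')"
  \<comment> \<open>At \<open>l'\<close>, every \<open>a\<close> in \<open>B l'\<close> gives a pair
    in \<open>G\<close>, so the maximality of \<open>(l', a')\<close> over \<open>G\<close> makes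
    \<open>a'\<close> leader-optimal in \<open>B l'\<close>.\<close>
  have r': "?r l \<in> argmax_set (U\<^sub>L x l) (B l)" if "l \<in> L" for l
    using bspec[OF r that] p max by (auto simp: mem_argmax_set_iff G_def)
  \<comment> \<open>The graph of \<open>?r\<close> over \<open>L\<close> lies in \<open>G\<close>,
    so no signal earns the leader more than the maximum over \<open>G\<close>, which
    \<open>l'\<close> attains.\<close>
  have "(l, ?r l) \<in> G" if "l \<in> L" for l
    using r'[OF that] that unfolding G_def mem_argmax_set_iff by blast
  then have "l' \<in> argmax_set (\<lambda>l. U\<^sub>L x l (?r l)) L"
    using p G(1) max unfolding mem_argmax_set_iff fun_upd_same by blast
  then have "optimistic_stackelberg_solution L A U\<^sub>L U\<^sub>F x (l', a')"
    using r' unfolding optimistic_stackelberg_solution_def best_response_eq prod.case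
    by (intro exI[of _ ?r]) simp
  then show ?thesis
    using p G(1) by blast
qed

end
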